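(* Assume $r\le m+n$ and $l=p$. Then there is a bijection from $\mathcal P_r$ to ${}^{\tau}\Lambda^{++}(m|n,r)$.
   Context: Let $m,n,r\ge1$ be integers and $l=p$ an odd prime. Partitions and $\mathcal P_r$. $\Lambda^+_{l\text{-reg}}(a)$ is the set of partitions of $a$ with no (nonzero) part repeated $l$ or more times; $\Lambda^+(N,a)$ is the set of partitions of $a$ with at most $N$ parts. $\mathcal R_r=\{\vec r=(r_{-1},r_0)\in\mathbb N^2: r_{-1}+lr_0=r\}$ (with $0\in\mathbb N$). $\mathcal P_{\vec r}=\Lambda^+_{l\text{-reg}}(r)$ if $r_0=0$, and $\mathcal P_{\vec r}=\bigcup_{i=0}^{r_0}\{(\lambda,\xi,\eta):\lambda\in\Lambda^+_{l\text{-reg}}(r_{-1}),\ \xi\in\Lambda^+(m,i),\ \eta\in\Lambda^+(n,r_0-i)\}$ if $r_0>0$. $\mathcal P_r=\bigcup_{\vec r\in\mathcal R_r}\mathcal P_{\vec r}$. The function $j$. Identify a partition $\lambda$ with its Young diagram $\{(i,j)\in\mathbb Z_{>0}^2: j\le\lambda_i\}$ ($i$ = row, $j$ = column). The rim of $\lambda$ is the set of nodes $(i,j)\in\lambda$ with $(i+1,j+1)\notin\lambda$. The $p$-rim is a subset of the rim, the union of the $p$-segments: the first $p$-segment consists of the first $p$ nodes of the rim, reading along the rim from left to right (starting from the bottom-left end); the next $p$-segment consists of the next $p$ nodes of the rim, starting from the column immediately to the right of the rightmost node of the first $p$-segment; and so on (all $p$-segments except possibly the last have exactly $p$ nodes,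 the last may have fewer). $J(\lambda)$ is the partition obtained from $\lambda$ by deleting every node of the $p$-rim that is at the rightmost end of a row of $\lambda$ but is not the $p$th node of a $p$-segment; $j(\lambda)=|\lambda|-|J(\lambda)|$. The set ${}^\tau\Lambda^{++}(m|n,r)$. $\Lambda(m|n,r)$ is the set of compositions $\lambda=(\lambda_1,\dots,\lambda_m|\lambda_{m+1},\dots,\lambda_{m+n})=(\lambda^{(0)}|\lambda^{(1)})$ of $r$ into $m+n$ nonnegative parts; $\Lambda^+(m|n,r)$ is the subset with $\lambda_1\ge\cdots\ge\lambda_m$ and $\lambda_{m+1}\ge\cdots\ge\lambda_{m+n}$; $t(\lambda)=(\lambda_{m+1},\dots,\lambda_{m+n})$. $\Lambda^{++}(m|n,r)=\{\lambda\in\Lambda^+(m|n,r): j(t(\lambda))\le\lambda_m\}$. The map $\tau:\Lambda(m|n,r)\to\Lambda(m+n|n,r)$ is $\tau(\lambda)=(\lambda^{(0)},0,\dots,0|\lambda^{(1)})$ ($n$ zeros inserted), and ${}^\tau\Lambda^{++}(m|n,r)=\tau(\Lambda^{++}(m|n,r))$. *)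

theory Defs
  imports Main "HOL-Computational_Algebra.Primes"
begin

section \<open>Partitions\<close>

text \<open>Partitions are weakly decreasing lists of positive natural numbers.\<close>

definition partitions_of :: "nat \<Rightarrow> nat list set" where
  "partitions_of a = {xs. sorted_wrt (\<ge>) xs \<and> 0 \<notin> set xs \<and> sum_list xs = a}"

definition l_regular_partitions :: "nat \<Rightarrow> nat \<Rightarrow> nat list set" where
  "l_regular_partitions l a = {xs \<in> partitions_of a. \<forall>k > 0. count_list xs k < l}"

definition bounded_partitions :: "nat \<Rightarrow> nat \<Rightarrow> nat list set" where
  "bounded_partitions N a = {xs \<in> partitions_of a. length xs \<le> N}"


section \<open>The index set \<open>\<P>\<^sub>r\<close>\<close>

text \<open>A pair \<open>(r\<^sub>-\<^sub>1, r\<^sub>0)\<close> of natural numbers.\<close>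

definition R_vecs :: "nat \<Rightarrow> nat \<Rightarrow> (nat \<times> nat) set" where
  "R_vecs l r = {(a, b). a + l * b = r}"

text \<open>
  Elements of the index set are either single partitions (left summand, when \<open>r\<^sub>0 = 0\<close>)
  or triples of partitions (right summand, when \<open>r\<^sub>0 > 0\<close>).
\<close>

type_synonym P_index = "nat list + nat list \<times> nat list \<times> nat list"

definition P_vec :: "nat \<Rightarrow> nat \<Rightarrow> nat \<Rightarrow> nat \<Rightarrow> nat \<times> nat \<Rightarrow> P_index set" where
  "P_vec l m n r rv =
     (if snd rv = 0 then Inl ` l_regular_partitions l r
      else Inr ` (\<Union>i\<in>{0..snd rv}. {(lam, xi, eta).
             lam \<in> l_regular_partitions l (fst rv) \<and>
             xi \<in> bounded_partitions m i \<and>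
             eta \<in> bounded_partitions n (snd rv - i)}))"

definition P_set :: "nat \<Rightarrow> nat \<Rightarrow> nat \<Rightarrow> nat \<Rightarrow> P_index set" where
  "P_set l m n r = (\<Union>rv\<in>R_vecs l r. P_vec l m n r rv)"


section \<open>The \<open>p\<close>-rim and the function \<open>j\<close>\<close>

text \<open>
  Nodes are pairs (row, column), both counted from 1. Zero entries of the list contribute no
  nodes, so the diagram of a decreasing list padded with zeros is that of the partition.
\<close>

definition young_diagram :: "nat list \<Rightarrow> (nat \<times> nat) set" where
  "young_diagram xs = {(i, k). 1 \<le> i \<and> i \<le> length xs \<and> 1 \<le> k \<and> k \<le> xs ! (i - 1)}"

definition rim :: "nat list \<Rightarrow> (nat \<times> nat) set" where
  "rim xs = {(i, k) \<in> young_diagram xs. (Suc i, Suc k) \<notin> young_diagram xs}"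

text \<open>
  Reading along the rim from the bottom-left end to the top-right end: columns from left to
  right, and each column from bottom to top.
\<close>

definition read_before :: "nat \<times> nat \<Rightarrow> nat \<times> nat \<Rightarrow> bool" where
  "read_before x y \<longleftrightarrow> snd x < snd y \<or> (snd x = snd y \<and> fst x > fst y)"

text \<open>
  The number of rim nodes in columns \<open>\<ge> c\<close> that are read before \<open>x\<close>. When reading starts in
  column \<open>c\<close>, the first \<open>p\<close> nodes are those of rank less than \<open>p\<close>, and the \<open>p\<close>th one is the
  one of rank \<open>p - 1\<close>.
\<close>

definition rim_rank :: "nat list \<Rightarrow> nat \<Rightarrow> nat \<times> nat \<Rightarrow> nat" where
  "rim_rank xs c x = card {y \<in> rim xs. c \<le> snd y \<and> read_before y x}"

definition segment :: "nat \<Rightarrow> nat list \<Rightarrow> nat \<Rightarrow> (nat \<times> nat) set" where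
  "segment p xs c = {x \<in> rim xs. c \<le> snd x \<and> rim_rank xs c x < p}"

definition is_pth_node :: "nat \<Rightarrow> nat list \<Rightarrow> nat \<Rightarrow> nat \<times> nat \<Rightarrow> bool" where
  "is_pth_node p xs c x \<longleftrightarrow> x \<in> segment p xs c \<and> Suc (rim_rank xs c x) = p"

text \<open>
  The columns in which the \<open>p\<close>-segments start. The \<open>p\<close>th node of a segment lies in the
  rightmost column of that segment; a segment without a \<open>p\<close>th node is the last one.
\<close>

inductive segment_start :: "nat \<Rightarrow> nat list \<Rightarrow> nat \<Rightarrow> bool" for p xs where
  first: "segment_start p xs 1"
| later: "segment_start p xs c \<Longrightarrow> is_pth_node p xs c x \<Longrightarrow> segment_start p xs (Suc (snd x))"

definition p_rim :: "nat \<Rightarrow> nat list \<Rightarrow> (nat \<times> nat) set" where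
  "p_rim p xs = (\<Union>c\<in>{c. segment_start p xs c}. segment p xs c)"

text \<open>\<open>J(\<lambda>)\<close> is given by its diagram.\<close>

definition J_diagram :: "nat \<Rightarrow> nat list \<Rightarrow> (nat \<times> nat) set" where
  "J_diagram p xs = young_diagram xs -
     {(i, k) \<in> p_rim p xs. (i, Suc k) \<notin> young_diagram xs \<and>
        \<not> (\<exists>c. segment_start p xs c \<and> is_pth_node p xs c (i, k))}"

definition j_fun :: "nat \<Rightarrow> nat list \<Rightarrow> nat" where
  "j_fun p xs = card (young_diagram xs) - card (J_diagram p xs)"


section \<open>The set \<open>\<^sup>\<tau>\<Lambda>\<^sup>+\<^sup>+(m|n,r)\<close>\<close>

text \<open>
  A composition \<open>(\<lambda>\<^sup>(\<^sup>0\<^sup>) | \<lambda>\<^sup>(\<^sup>1\<^sup>))\<close> is a pair of lists of lengths exactly \<open>m\<close> and \<open>n\<close>, zero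
  parts included; \<open>t(\<lambda>)\<close> is the second component and \<open>\<lambda>\<^sub>m\<close> is the entry at index \<open>m - 1\<close> of
  the first.
\<close>

definition Lam :: "nat \<Rightarrow> nat \<Rightarrow> nat \<Rightarrow> (nat list \<times> nat list) set" where
  "Lam m n r = {(xs, ys). length xs = m \<and> length ys = n \<and> sum_list xs + sum_list ys = r}"

definition Lam_plus :: "nat \<Rightarrow> nat \<Rightarrow> nat \<Rightarrow> (nat list \<times> nat list) set" where
  "Lam_plus m n r = {(xs, ys) \<in> Lam m n r. sorted_wrt (\<ge>) xs \<and> sorted_wrt (\<ge>) ys}"

definition Lam_pp :: "nat \<Rightarrow> nat \<Rightarrow> nat \<Rightarrow> nat \<Rightarrow> (nat list \<times> nat list) set" where
  "Lam_pp p m n r = {(xs, ys) \<in> Lam_plus m n r. j_fun p ys \<le> xs ! (m - 1)}"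

definition tau :: "nat \<Rightarrow> nat list \<times> nat list \<Rightarrow> nat list \<times> nat list" where
  "tau n lam = (fst lam @ replicate n 0, snd lam)"

definition tau_Lam_pp :: "nat \<Rightarrow> nat \<Rightarrow> nat \<Rightarrow> nat \<Rightarrow> (nat list \<times> nat list) set" where
  "tau_Lam_pp p m n r = tau n ` Lam_pp p m n r"

end

theory Submission
  imports Defs
begin

text \<open>
  The idea is to encode the second component of an element of \<open>\<Lambda>\<^sup>+\<^sup>+(m|n,r)\<close> by iterating \<open>J\<close>.

  Read the rows of a partition \<open>\<lambda>\<close> from the shortest to the longest. Following the \<open>p\<close>-segments
  along the rim shows that a row of length \<open>x\<close> loses its last node in \<open>J(\<lambda>)\<close> if and only if \<open>p\<close>
  does not divide \<open>x + e\<close>, where \<open>e\<close> is the number of rows below it that lose theirs. Hence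
  \<open>j(\<lambda>)\<close> is computed by one pass over the rows (\<open>j_fun_eq_removal_count\<close>).

  The number \<open>x + e\<close> does not change if both terms are taken after the deletion in the row
  concerned. So \<open>\<lambda>\<close> can be recovered from \<open>J(\<lambda>)\<close> and \<open>k = j(\<lambda>)\<close>, starting with the longest
  row. The pairs \<open>(\<mu>, k)\<close> that occur as \<open>(J(\<lambda>), j(\<lambda>))\<close> are those with
  \<open>j(\<mu>) \<le> k < j(\<mu>) + p\<close> (\<open>remove_ends_window\<close>, \<open>restore_ends_inverse\<close>). Iterating \<open>J\<close> until it
  becomes stationary therefore encodes \<open>\<lambda>\<close> by the sequence \<open>j(\<lambda>), j(J(\<lambda>)), \<dots>\<close>, which is a
  \<open>p\<close>-restricted partition \<open>\<zeta>\<close> with largest part \<open>j(\<lambda>)\<close>, and by the stationary end, which is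
  \<open>p\<close> times a partition \<open>\<eta>\<close>. Every pair \<open>(\<zeta>, \<eta>)\<close> occurs, and \<open>\<bar>\<lambda>\<bar> = \<bar>\<zeta>\<bar> + p\<bar>\<eta>\<bar>\<close>.

  Apply this to the second component of \<open>(\<lambda>\<^sup>(\<^sup>0\<^sup>) | \<lambda>\<^sup>(\<^sup>1\<^sup>))\<close>. The condition
  \<open>j(\<lambda>\<^sup>(\<^sup>1\<^sup>)) \<le> \<lambda>\<^sub>m\<close> says precisely that \<open>\<lambda>\<^sup>(\<^sup>0\<^sup>)\<close> followed by \<open>\<zeta>\<close> is a partition, whose
  successive differences are less than \<open>p\<close> after the first \<open>m\<close> ones. Division with remainder of
  those first \<open>m\<close> differences writes it uniquely as a \<open>p\<close>-restricted partition plus \<open>p\<close> times a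
  partition \<open>\<xi>\<close> with at most \<open>m\<close> parts. The conjugate of the restricted partition is
  \<open>p\<close>-regular, and together with \<open>\<xi>\<close> and \<open>\<eta>\<close> it forms the corresponding element of \<open>\<P>\<^sub>r\<close>.

  All partitions in the middle of the argument are lists of fixed length, padded with zeros. That
  \<open>m + n\<close> and \<open>n\<close> entries suffice follows from \<open>r \<le> m + n\<close>: if \<open>\<zeta>\<close> is not zero, then every
  entry of \<open>\<lambda>\<^sup>(\<^sup>0\<^sup>)\<close> is positive, and only \<open>r - m \<le> n\<close> is left for the size of \<open>\<lambda>\<^sup>(\<^sup>1\<^sup>)\<close>.
\<close>

section \<open>Counting deleted row ends in one pass\<close>

abbreviation decreasing :: "nat list \<Rightarrow> bool" where
  "decreasing \<equiv> sorted_wrt (\<ge>)"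

fun first_part :: "nat list \<Rightarrow> nat" where
  "first_part [] = 0"
| "first_part (x # xs) = x"

lemma decreasing_Cons:
  "decreasing (x # xs) \<longleftrightarrow> first_part xs \<le> x \<and> decreasing xs"
  by (cases xs) auto

text \<open>
  Recursions along a list only ever compare a part with the next one, so the local form of the
  monotonicity condition replaces the quantified one in the simplifier.
\<close>

declare sorted_wrt.simps(2) [simp del] decreasing_Cons [simp]

text \<open>
  Counts the rows which are shortened in the passage from \<open>\<lambda>\<close> to \<open>J(\<lambda>)\<close>. The tail of the list
  consists of the rows below its head, so the recursion runs upwards through the diagram, like the
  reading of the rim.
\<close>

fun removal_count :: "nat \<Rightarrow> nat list \<Rightarrow> nat" where
  "removal_count p [] = 0"
| "removal_count p (x # xs) =
     removal_count p xs + of_bool (\<not> p dvd x + removal_count p xs)"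

lemma removal_count_zeros:
  assumes "decreasing xs" "first_part xs = 0"
  shows "removal_count p xs = 0" "sum_list xs = 0"
proof -
  have "x = 0" if "x \<in> set xs" for x
    using assms that by (cases xs) (auto simp: sorted_wrt.simps(2) simp del: decreasing_Cons)
  then have "xs = replicate (length xs) 0"
    by (simp add: replicate_length_same)
  moreover have "removal_count p (replicate n 0) = 0" "sum_list (replicate n (0::nat)) = 0" for n
    by (induction n) simp_all
  ultimately show "removal_count p xs = 0" "sum_list xs = 0"
    by metis+
qed

lemma removal_count_eq_0_iff:
  "removal_count p xs = 0 \<longleftrightarrow> (\<forall>x\<in>set xs. p dvd x)"
  by (induction xs) auto

text \<open>
  Below an empty row there are only empty rows, none of which is shortened, and \<open>p\<close> divides 0.
  So no row is shortened below length 0.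
\<close>

lemma removed_end_positive:
  assumes "decreasing (x # xs)" "\<not> p dvd x + removal_count p xs"
  shows "0 < x"
proof (rule gr0I)
  assume "x = 0"
  with assms(1) have "removal_count p xs = 0"
    by (intro removal_count_zeros) simp_all
  with assms(2) \<open>x = 0\<close> show False by simp
qed

section \<open>The rim as a walk and the positions of the segments\<close>

text \<open>
  The length of column \<open>c\<close>, which is also the row of its lowest node.
\<close>

definition rows_reaching :: "nat list \<Rightarrow> nat \<Rightarrow> nat" where
  "rows_reaching ys c = length (filter (\<lambda>y. c \<le> y) ys)"

lemma le_rows_reaching_iff:
  assumes "decreasing ys" "1 \<le> i" "i \<le> length ys"
  shows "i \<le> rows_reaching ys c \<longleftrightarrow> c \<le> ys ! (i - 1)"
  using assms
proof (induction ys arbitrary: i)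
  case (Cons y ys)
  show ?case
  proof (cases "i = 1")
    case True
    have "filter ((\<le>) c) ys = []" if "\<not> c \<le> y"
      using that Cons.prems(1)
      by (auto simp: filter_empty_conv sorted_wrt.simps(2) simp del: decreasing_Cons)
    then show ?thesis
      using True by (auto simp: rows_reaching_def)
  next
    case False
    then obtain i' where i': "i = Suc i'" "1 \<le> i'" "i' \<le> length ys"
      using Cons.prems by (cases i) auto
    have "ys ! (i' - 1) \<le> y"
      using Cons.prems(1) i' by (auto simp: sorted_wrt.simps(2) simp del: decreasing_Cons)
    moreover have "i' \<le> rows_reaching ys c \<longleftrightarrow> c \<le> ys ! (i' - 1)"
      using Cons i' by auto
    moreover have "(y # ys) ! (i - 1) = ys ! (i' - 1)"
      using i' by (simp add: nth_Cons')
    ultimately show ?thesis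
      using i' by (auto simp: rows_reaching_def)
  qed
qed simp

lemma rows_reaching_antimono: "c \<le> k \<Longrightarrow> rows_reaching ys k \<le> rows_reaching ys c"
  by (induction ys) (auto simp: rows_reaching_def)

lemma rows_reaching_le_length: "rows_reaching ys c \<le> length ys"
  by (simp add: rows_reaching_def)

lemma young_diagram_iff:
  assumes "decreasing ys"
  shows "(i, k) \<in> young_diagram ys \<longleftrightarrow> 1 \<le> i \<and> 1 \<le> k \<and> i \<le> rows_reaching ys k"
  using le_rows_reaching_iff[OF assms, of i k] rows_reaching_le_length[of ys k]
  by (auto simp: young_diagram_def)

lemma young_diagram_down:
  assumes "decreasing ys" "(i, k) \<in> young_diagram ys" "1 \<le> i'" "i' \<le> i" "1 \<le> k'" "k' \<le> k"
  shows "(i', k') \<in> young_diagram ys"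
proof -
  have "ys ! (i - 1) \<le> ys ! (i' - 1)"
    using assms sorted_wrt_nth_less[OF assms(1), of "i' - 1" "i - 1"]
    by (cases "i' = i") (auto simp: young_diagram_def)
  then show ?thesis
    using assms by (auto simp: young_diagram_def)
qed

lemma finite_young_diagram: "finite (young_diagram ys)"
proof (rule finite_subset)
  show "young_diagram ys \<subseteq> (SIGMA i:{1..length ys}. {1..ys ! (i - 1)})"
    by (auto simp: young_diagram_def)
qed simp

lemma finite_rim: "finite (rim ys)"
  by (rule finite_subset[OF _ finite_young_diagram[of ys]]) (auto simp: rim_def)

text \<open>
  Reading order is transitive, and a node does not precede itself.
\<close>

lemma rim_rank_mono:
  assumes "read_before y x" "y \<in> rim ys" "c \<le> snd y"
  shows "rim_rank ys c y < rim_rank ys c x"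
  unfolding rim_rank_def
proof (rule psubset_card_mono)
  show "finite {z \<in> rim ys. c \<le> snd z \<and> read_before z x}"
    using finite_rim by simp
  show "{z \<in> rim ys. c \<le> snd z \<and> read_before z y}
      \<subset> {z \<in> rim ys. c \<le> snd z \<and> read_before z x}"
    using assms by (auto simp: read_before_def)
qed

text \<open>
  The next two lemmas describe the rim as a walk. The predecessor of a rim node is the node below
  it if that belongs to the diagram, and the node to its left otherwise; in both cases no other
  rim node lies in between.
\<close>

lemma rim_rank_above:
  assumes "decreasing ys" "(i, k) \<in> rim ys" "(Suc i, k) \<in> young_diagram ys" "c \<le> k"
  shows "(Suc i, k) \<in> rim ys" "rim_rank ys c (i, k) = Suc (rim_rank ys c (Suc i, k))"
proof -
  show rim: "(Suc i, k) \<in> rim ys"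
    using assms young_diagram_down[OF assms(1), of "Suc (Suc i)" "Suc k" "Suc i" "Suc k"]
    by (auto simp: rim_def)
  have "{y \<in> rim ys. c \<le> snd y \<and> read_before y (i, k)}
      = insert (Suc i, k) {y \<in> rim ys. c \<le> snd y \<and> read_before y (Suc i, k)}"
    using rim assms(4) by (auto simp: read_before_def)
  then show "rim_rank ys c (i, k) = Suc (rim_rank ys c (Suc i, k))"
    using finite_rim by (simp add: rim_rank_def read_before_def)
qed

lemma rim_rank_right:
  assumes "decreasing ys" "(i, Suc k) \<in> rim ys" "(Suc i, Suc k) \<notin> young_diagram ys"
    and "1 \<le> c" "c \<le> k"
  shows "(i, k) \<in> rim ys" "rim_rank ys c (i, Suc k) = Suc (rim_rank ys c (i, k))"
proof -
  show rim: "(i, k) \<in> rim ys"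
    using assms by (auto simp: rim_def young_diagram_def)
  have same_column: "\<not> i < fst y" if "y \<in> rim ys" "snd y = Suc k" for y
    using that assms(3) young_diagram_down[OF assms(1), of "fst y" "Suc k" "Suc i" "Suc k"]
    by (cases y) (auto simp: rim_def)
  have previous_column: "i \<le> fst y" if "y \<in> rim ys" "snd y = k" for y
  proof (rule ccontr)
    assume "\<not> i \<le> fst y"
    then have "(Suc (fst y), Suc k) \<in> young_diagram ys"
      using assms(2) young_diagram_down[OF assms(1), of i "Suc k" "Suc (fst y)" "Suc k"]
      by (auto simp: rim_def)
    then show False
      using that by (cases y) (auto simp: rim_def)
  qed
  have "{y \<in> rim ys. c \<le> snd y \<and> read_before y (i, Suc k)}
      = insert (i, k) {y \<in> rim ys. c \<le> snd y \<and> read_before y (i, k)}"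
    using rim assms(5) same_column previous_column
    by (auto simp: read_before_def less_Suc_eq le_less) force+
  then show "rim_rank ys c (i, Suc k) = Suc (rim_rank ys c (i, k))"
    using finite_rim by (simp add: rim_rank_def read_before_def)
qed

lemma rim_rank_bottom:
  assumes "decreasing ys" "(i, c) \<in> rim ys" "(Suc i, c) \<notin> young_diagram ys"
  shows "rim_rank ys c (i, c) = 0"
proof -
  have "\<not> (c \<le> snd y \<and> read_before y (i, c))" if "y \<in> rim ys" for y
    using that assms(2,3) young_diagram_down[OF assms(1), of "fst y" "snd y" "Suc i" c]
    by (cases y) (auto simp: rim_def read_before_def young_diagram_def)
  then have "{y \<in> rim ys. c \<le> snd y \<and> read_before y (i, c)} = {}"
    by blast
  then show ?thesis
    by (simp only: rim_rank_def card.empty)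
qed

lemma rim_rank_cases:
  assumes "decreasing ys" "(i, k) \<in> rim ys" "1 \<le> c" "c \<le> k"
  obtains (bottom) "k = c" "i = rows_reaching ys c" "rim_rank ys c (i, k) = 0"
  | (up) "(Suc i, k) \<in> rim ys" "rim_rank ys c (i, k) = Suc (rim_rank ys c (Suc i, k))"
  | (right) k' where "k = Suc k'" "c \<le> k'" "(i, k') \<in> rim ys"
      "rim_rank ys c (i, k) = Suc (rim_rank ys c (i, k'))"
proof (cases "(Suc i, k) \<in> young_diagram ys")
  case True
  then show ?thesis
    using rim_rank_above[OF assms(1,2) _ assms(4)] up by blast
next
  case False
  show ?thesis
  proof (cases "k = c")
    case True
    moreover have "i = rows_reaching ys c"
      using False True assms(2,3) by (auto simp: rim_def young_diagram_iff[OF assms(1)])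
    moreover have "rim_rank ys c (i, k) = 0"
      using True rim_rank_bottom[OF assms(1), of i c] False assms(2) by simp
    ultimately show ?thesis
      using bottom by blast
  next
    case ne: False
    then obtain k' where "k = Suc k'" "c \<le> k'"
      using assms(4) by (cases k) auto
    then show ?thesis
      using right rim_rank_right[OF assms(1), of i k'] False assms by blast
  qed
qed

text \<open>
  Each step of the walk raises column minus row by one. The walk through the columns from \<open>c\<close>
  on starts at the bottom of column \<open>c\<close>, in row \<open>rows_reaching ys c\<close>, so the rank is the
  difference of these values.
\<close>

lemma rim_rank_formula:
  assumes "decreasing ys" "(i, k) \<in> rim ys" "1 \<le> c" "c \<le> k"
  shows "i + c + rim_rank ys c (i, k) = k + rows_reaching ys c"
  using assms(2,4)
proof (induction "rim_rank ys c (i, k)" arbitrary: i k rule: less_induct)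
  case less
  show ?case
    using assms(1) less.prems(1) assms(3) less.prems(2)
  proof (cases rule: rim_rank_cases)
    case up
    then show ?thesis using less.hyps[of "Suc i" k] less.prems by auto
  next
    case (right k')
    then show ?thesis using less.hyps[of i k'] by auto
  qed auto
qed

text \<open>
  Walking backwards lowers the rank in steps of one, hence no value is skipped. This provides the
  \<open>p\<close>th node of a segment as soon as some later node is not in that segment.
\<close>

lemma rim_rank_attained:
  assumes "decreasing ys" "(i, k) \<in> rim ys" "1 \<le> c" "c \<le> k" "v \<le> rim_rank ys c (i, k)"
  shows "\<exists>y. y \<in> rim ys \<and> c \<le> snd y \<and> rim_rank ys c y = v"
  using assms(2,4,5)
proof (induction "rim_rank ys c (i, k)" arbitrary: i k rule: less_induct)
  case less
  show ?case
  proof (cases "v = rim_rank ys c (i, k)")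
    case True
    then show ?thesis using less.prems by (intro exI[of _ "(i, k)"]) auto
  next
    case False
    show ?thesis
      using assms(1) less.prems(1) assms(3) less.prems(2)
    proof (cases rule: rim_rank_cases)
      case bottom
      then show ?thesis using False less.prems by auto
    next
      case up
      then show ?thesis using less.hyps[of "Suc i" k] less.prems False by auto
    next
      case (right k')
      then show ?thesis using less.hyps[of i k'] less.prems False by auto
    qed
  qed
qed

text \<open>
  Rows are numbered from 1, so this counts the shortened rows strictly below row \<open>i\<close>, and the
  length of row \<open>i\<close> itself is the entry at index \<open>i - 1\<close>.
\<close>

abbreviation removed_below :: "nat \<Rightarrow> nat list \<Rightarrow> nat \<Rightarrow> nat" where
  "removed_below p ys i \<equiv> removal_count p (drop i ys)"

lemma removed_below_step:
  assumes "1 \<le> i" "i \<le> length ys"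
  shows "removed_below p ys (i - 1) =
    removed_below p ys i + of_bool (\<not> p dvd ys ! (i - 1) + removed_below p ys i)"
proof -
  have "drop (i - 1) ys = ys ! (i - 1) # drop i ys"
    using assms Cons_nth_drop_Suc[of "i - 1" ys] by simp
  then show ?thesis by simp
qed

lemma row_end_in_rim:
  assumes "decreasing ys" "1 \<le> i" "i \<le> length ys" "0 < ys ! (i - 1)"
  shows "(i, ys ! (i - 1)) \<in> rim ys"
proof -
  have "(i, Suc (ys ! (i - 1))) \<notin> young_diagram ys"
    by (simp add: young_diagram_def)
  then have "(Suc i, Suc (ys ! (i - 1))) \<notin> young_diagram ys"
    using young_diagram_down[OF assms(1), of "Suc i" "Suc (ys ! (i - 1))" i "Suc (ys ! (i - 1))"]
      assms(2) by auto
  then show ?thesis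
    using assms by (auto simp: rim_def young_diagram_def)
qed

text \<open>
  The invariant of the segment starts. Modulo \<open>p\<close>, such a column behaves like the first one: a
  row end of rank \<open>s - 1\<close> in the segment starting at \<open>c\<close> has row length plus number of shortened
  rows below it congruent to \<open>s\<close>.
\<close>

definition aligned :: "nat \<Rightarrow> nat list \<Rightarrow> nat \<Rightarrow> bool" where
  "aligned p ys c \<longleftrightarrow> 1 \<le> c \<and> p dvd c - 1 + removed_below p ys (rows_reaching ys c)"

text \<open>
  The ends of the rows of the segment below \<open>(i, k)\<close> have a rank too small to be the \<open>p\<close>th
  node. By the invariant \<open>p\<close> divides none of the numbers which decide about these rows, so all
  of them are counted as shortened.
\<close>

lemma removed_below_in_segment:
  assumes dec: "decreasing ys" and "aligned p ys c"
    and "(i, k) \<in> rim ys" "c \<le> k" "rim_rank ys c (i, k) < p"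
  shows "removed_below p ys i = removed_below p ys (rows_reaching ys c) + (rows_reaching ys c - i)"
proof -
  let ?h = "rows_reaching ys c"
  have c: "1 \<le> c" and start: "p dvd c - 1 + removed_below p ys ?h"
    using assms(2) by (auto simp: aligned_def)
  have "i \<le> rows_reaching ys k"
    using assms(3) by (auto simp: rim_def young_diagram_iff[OF dec])
  also have "\<dots> \<le> ?h"
    using assms(4) by (rule rows_reaching_antimono)
  finally have "i \<le> ?h" .
  have i: "1 \<le> i" "i \<le> length ys" "k \<le> ys ! (i - 1)" "(Suc i, Suc k) \<notin> young_diagram ys"
    using assms(3) by (auto simp: rim_def young_diagram_def)
  show ?thesis
    using \<open>i \<le> ?h\<close>
  proof (induction rule: inc_induct)
    case (step i')
    let ?y = "ys ! i'"
    have i': "Suc i' \<le> length ys" "c \<le> ?y"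
      using step(2) rows_reaching_le_length[of ys c] le_rows_reaching_iff[OF dec, of "Suc i'" c]
      by auto
    have rim: "(Suc i', ?y) \<in> rim ys"
      using row_end_in_rim[OF dec, of "Suc i'"] i' c by auto
    have "?y \<le> k"
    proof (rule ccontr)
      assume "\<not> ?y \<le> k"
      then show False
        using i(4) young_diagram_down[OF dec, of "Suc i'" ?y "Suc i" "Suc k"] rim step(1)
        by (auto simp: rim_def)
    qed
    then have "rim_rank ys c (Suc i', ?y) < rim_rank ys c (i, k)"
      using step(1) rim i' by (intro rim_rank_mono) (auto simp: read_before_def)
    then have "Suc (rim_rank ys c (Suc i', ?y)) < p"
      using assms(5) by simp
    then have nd: "\<not> p dvd Suc (rim_rank ys c (Suc i', ?y))"
      using nat_dvd_not_less by blast
    have "?y + removed_below p ys (Suc i')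
        = (c - 1 + removed_below p ys ?h) + Suc (rim_rank ys c (Suc i', ?y))"
      using rim_rank_formula[OF dec rim c i'(2)] step c by simp
    then have "\<not> p dvd ?y + removed_below p ys (Suc i')"
      using nd start dvd_add_right_iff[OF start, of "Suc (rim_rank ys c (Suc i', ?y))"] by simp
    then show ?case
      using removed_below_step[of "Suc i'" ys p] i' step by simp
  qed simp
qed

text \<open>
  Adding the rank formula to the count of shortened rows makes the row number cancel, which
  leaves the invariant of \<open>c\<close> plus the position of the node in its segment.
  The criterion does not mention \<open>c\<close>, hence it does not matter which segment contains the node.
\<close>

lemma rank_congruence:
  assumes dec: "decreasing ys" and "aligned p ys c"
    and "(i, k) \<in> rim ys" "c \<le> k" "rim_rank ys c (i, k) < p"
  shows "p dvd k + removed_below p ys i \<longleftrightarrow> Suc (rim_rank ys c (i, k)) = p"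
proof -
  let ?h = "rows_reaching ys c"
  have c: "1 \<le> c" and start: "p dvd c - 1 + removed_below p ys ?h"
    using assms(2) by (auto simp: aligned_def)
  let ?r = "Suc (rim_rank ys c (i, k))"
  have "i \<le> rows_reaching ys k"
    using assms(3) by (auto simp: rim_def young_diagram_iff[OF dec])
  also have "\<dots> \<le> ?h"
    using assms(4) by (rule rows_reaching_antimono)
  finally have "i \<le> ?h" .
  then have "k + removed_below p ys i = (c - 1 + removed_below p ys ?h) + ?r"
    using rim_rank_formula[OF dec assms(3) c assms(4)] removed_below_in_segment[OF assms] c
    by simp
  then have "p dvd k + removed_below p ys i \<longleftrightarrow> p dvd ?r"
    using dvd_add_right_iff[OF start, of ?r] by simp
  also have "\<dots> \<longleftrightarrow> ?r = p"
    using assms(5) by (auto dest: dvd_imp_le)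
  finally show ?thesis .
qed

text \<open>
  Once a row of length \<open>k\<close> keeps its end, so do all rows of the same length above it: the deciding
  number is the same for all of them.
\<close>

lemma removed_below_equal_rows:
  assumes "p dvd k + removed_below p ys i" "i' \<le> i" "i \<le> length ys"
    and "\<And>t. i' \<le> t \<Longrightarrow> t < i \<Longrightarrow> ys ! t = k"
  shows "removed_below p ys i' = removed_below p ys i"
  using assms(2)
proof (induction rule: inc_induct)
  case (step t)
  then show ?case
    using removed_below_step[of "Suc t" ys p] assms by auto
qed simp

text \<open>
  A new segment starts to the right of a \<open>p\<close>th node \<open>(i, k)\<close>, for which \<open>p\<close> divides
  \<open>k\<close> plus the number of shortened rows below row \<open>i\<close>. The rows that end in column \<open>k\<close> from
  row \<open>i\<close> upwards are not shortened, so the count is still the same when column \<open>k + 1\<close> is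
  reached.
\<close>

lemma segment_start_aligned:
  assumes dec: "decreasing ys" and "segment_start p ys c"
  shows "aligned p ys c"
  using assms(2)
proof induction
  case first
  have "removed_below p ys (rows_reaching ys 1) = 0"
    unfolding removal_count_eq_0_iff
  proof
    fix x assume "x \<in> set (drop (rows_reaching ys 1) ys)"
    then obtain t where t: "rows_reaching ys 1 \<le> t" "t < length ys" "x = ys ! t"
      by (auto simp: in_set_conv_nth) (metis add.commute le_add2 less_diff_conv)
    then have "\<not> 1 \<le> ys ! t"
      using le_rows_reaching_iff[OF dec, of "Suc t" 1] by simp
    then show "p dvd x"
      using t(3) by (simp add: not_le)
  qed
  then show ?case by (simp add: aligned_def)
next
  case (later c x)
  obtain i k where x: "x = (i, k)" by (cases x)
  have ik: "(i, k) \<in> rim ys" "c \<le> k" "rim_rank ys c (i, k) < p" "Suc (rim_rank ys c (i, k)) = p"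
    using later(2) by (auto simp: x is_pth_node_def segment_def)
  have d: "p dvd k + removed_below p ys i"
    using rank_congruence[OF dec later(3) ik(1-3)] ik(4) by simp
  have i: "1 \<le> i" "i \<le> length ys" "k \<le> ys ! (i - 1)" "(Suc i, Suc k) \<notin> young_diagram ys"
    using ik(1) by (auto simp: rim_def young_diagram_def)
  let ?h = "rows_reaching ys (Suc k)"
  have "?h \<le> i"
    using i(4) by (auto simp: young_diagram_iff[OF dec] not_less_eq_eq)
  moreover have "ys ! t = k" if "?h \<le> t" "t < i" for t
  proof -
    have "ys ! (i - 1) \<le> ys ! t"
      using that i sorted_wrt_nth_less[OF dec, of t "i - 1"] by (cases "t = i - 1") auto
    then show ?thesis
      using that i le_rows_reaching_iff[OF dec, of "Suc t" "Suc k"] by auto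
  qed
  ultimately have "removed_below p ys ?h = removed_below p ys i"
    using removed_below_equal_rows[OF d _ i(2), of ?h] by blast
  then show ?case
    using d by (simp add: x aligned_def)
qed

text \<open>
  A row end can be missing from the \<open>p\<close>-rim only if a segment ends below it in the same column.
  That leaves \<open>p\<close> dividing the number which decides about the row.
\<close>

lemma row_end_in_p_rim:
  assumes dec: "decreasing ys" and "0 < p"
    and i: "1 \<le> i" "i \<le> length ys" and pos: "0 < ys ! (i - 1)"
    and nd: "\<not> p dvd ys ! (i - 1) + removed_below p ys i"
  shows "(i, ys ! (i - 1)) \<in> p_rim p ys"
proof -
  let ?b = "ys ! (i - 1)"
  \<comment> \<open>The last segment start weakly to the left of the row end; 1 is always a candidate.\<close>
  let ?S = "{c. segment_start p ys c \<and> c \<le> ?b}"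
  define c where "c = Max ?S"
  have S: "finite ?S" "1 \<in> ?S"
    using pos segment_start.first[of p ys] by auto
  then have c: "segment_start p ys c" "c \<le> ?b"
    using Max_in[of ?S] unfolding c_def by blast+
  note al = segment_start_aligned[OF dec c(1)]
  note rim = row_end_in_rim[OF dec i pos]
  have "rim_rank ys c (i, ?b) < p"
  proof (rule ccontr)
    assume "\<not> ?thesis"
    then obtain y where y: "y \<in> rim ys" "c \<le> snd y" "rim_rank ys c y = p - 1"
      using rim_rank_attained[OF dec rim _ c(2), of "p - 1"] al unfolding aligned_def
      by (metis diff_le_self le_trans not_less)
    obtain i' k where yik: "y = (i', k)" by (cases y)
    have "is_pth_node p ys c y"
      using y assms(2) by (auto simp: is_pth_node_def segment_def)
    then have start: "segment_start p ys (Suc k)"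
      using segment_start.later[OF c(1)] yik by auto
    have before: "\<not> read_before (i, ?b) y" "y \<noteq> (i, ?b)"
      using rim_rank_mono[of "(i, ?b)" y ys c] rim c(2) y(3) \<open>\<not> rim_rank ys c (i, ?b) < p\<close> assms(2)
      by auto
    have "\<not> Suc k \<le> ?b"
    proof
      assume "Suc k \<le> ?b"
      then have "Suc k \<le> c"
        unfolding c_def using start S by (intro Max_ge) auto
      then show False
        using y(2) yik by simp
    qed
    then have "k = ?b" "i < i'"
      using before yik by (auto simp: read_before_def)
    have d: "p dvd k + removed_below p ys i'"
      using rank_congruence[OF dec al, of i' k] y yik assms(2) by simp
    have i': "i' \<le> length ys" "k \<le> ys ! (i' - 1)"
      using y(1) yik by (auto simp: rim_def young_diagram_def)
    have "ys ! t = k" if "i \<le> t" "t < i'" for t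
    proof -
      have "ys ! (i' - 1) \<le> ys ! t"
        using that i' sorted_wrt_nth_less[OF dec, of t "i' - 1"] by (cases "t = i' - 1") auto
      moreover have "ys ! t \<le> ?b"
        using that i i' sorted_wrt_nth_less[OF dec, of "i - 1" t] by auto
      ultimately show ?thesis
        using i' \<open>k = ?b\<close> by simp
    qed
    then have "removed_below p ys i = removed_below p ys i'"
      using removed_below_equal_rows[OF d _ i'(1), of i] \<open>i < i'\<close> by simp
    then show False
      using nd d \<open>k = ?b\<close> by simp
  qed
  then have "(i, ?b) \<in> segment p ys c"
    using rim c(2) by (simp add: segment_def)
  then show ?thesis
    using c(1) by (auto simp: p_rim_def)
qed

lemma card_removed_rows:
  "card {i. 1 \<le> i \<and> i \<le> length ys \<and> \<not> p dvd ys ! (i - 1) + removed_below p ys i} = removal_count p ys"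
proof -
  have "card {i \<in> {t<..length ys}. \<not> p dvd ys ! (i - 1) + removed_below p ys i} = removed_below p ys t"
    if "t \<le> length ys" for t
    using that
  proof (induction rule: inc_induct)
    case (step t)
    have "{t<..length ys} = insert (Suc t) {Suc t<..length ys}"
      using step(2) by auto
    then have "{i \<in> {t<..length ys}. \<not> p dvd ys ! (i - 1) + removed_below p ys i}
      = (if p dvd ys ! t + removed_below p ys (Suc t) then {} else {Suc t}) \<union>
        {i \<in> {Suc t<..length ys}. \<not> p dvd ys ! (i - 1) + removed_below p ys i}"
      by auto
    then show ?case
      using step removed_below_step[of "Suc t" ys p] by auto
  qed simp
  from this[of 0] show ?thesis
    by (simp add: greaterThanAtMost_def greaterThan_def atMost_def Suc_le_eq)
qed

text \<open>
  A deleted node ends its row, lies in some segment and is not a \<open>p\<close>th node. For a row end in a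
  segment the last condition is the divisibility criterion, and the row ends that meet the
  criterion do lie in a segment. Hence deleted nodes correspond to the rows counted by
  \<open>removal_count\<close>.
\<close>

theorem j_fun_eq_removal_count:
  assumes dec: "decreasing ys" and "0 < p"
  shows "j_fun p ys = removal_count p ys"
proof -
  define R where "R = {i. 1 \<le> i \<and> i \<le> length ys \<and> \<not> p dvd ys ! (i - 1) + removed_below p ys i}"
  define del where "del = {(i, k) \<in> p_rim p ys. (i, Suc k) \<notin> young_diagram ys \<and>
    \<not> (\<exists>c. segment_start p ys c \<and> is_pth_node p ys c (i, k))}"
  have pth: "is_pth_node p ys c (i, k) \<longleftrightarrow> p dvd k + removed_below p ys i"
    if "segment_start p ys c" "(i, k) \<in> segment p ys c" for c i k
    using that rank_congruence[OF dec segment_start_aligned[OF dec that(1)], of i k]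
    by (auto simp: is_pth_node_def segment_def)
  have "del = (\<lambda>i. (i, ys ! (i - 1))) ` R"
  proof (intro equalityI subsetI)
    fix x assume "x \<in> del"
    then obtain i k c where x: "x = (i, k)" "segment_start p ys c" "(i, k) \<in> segment p ys c"
        "(i, Suc k) \<notin> young_diagram ys" "\<not> is_pth_node p ys c (i, k)"
      by (auto simp: del_def p_rim_def)
    then have "(i, k) \<in> young_diagram ys"
      by (auto simp: segment_def rim_def)
    then have "k = ys ! (i - 1)" "1 \<le> i" "i \<le> length ys"
      using x(4) by (auto simp: young_diagram_def)
    then show "x \<in> (\<lambda>i. (i, ys ! (i - 1))) ` R"
      using x pth by (auto simp: R_def)
  next
    fix x assume "x \<in> (\<lambda>i. (i, ys ! (i - 1))) ` R"
    then obtain i where x: "x = (i, ys ! (i - 1))" and i: "1 \<le> i" "i \<le> length ys"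
        and nd: "\<not> p dvd ys ! (i - 1) + removed_below p ys i"
      by (auto simp: R_def)
    have "decreasing (ys ! (i - 1) # drop i ys)"
      using i Cons_nth_drop_Suc[of "i - 1" ys] sorted_wrt_drop[OF dec, of "i - 1"] by simp
    then have "0 < ys ! (i - 1)"
      using removed_end_positive nd by blast
    then have "(i, ys ! (i - 1)) \<in> p_rim p ys"
      using row_end_in_p_rim[OF dec assms(2) i _ nd] by simp
    moreover have "\<not> is_pth_node p ys c (i, ys ! (i - 1))" if "segment_start p ys c" for c
      using pth[OF that] nd by (auto simp: is_pth_node_def)
    ultimately show "x \<in> del"
      by (auto simp: del_def x young_diagram_def)
  qed
  moreover have "inj_on (\<lambda>i. (i, ys ! (i - 1))) R"
    by (auto simp: inj_on_def)
  ultimately have "card del = removal_count p ys"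
    using card_removed_rows[of ys p] by (simp add: card_image R_def)
  moreover have "del \<subseteq> young_diagram ys"
    by (auto simp: del_def p_rim_def segment_def rim_def)
  moreover have "J_diagram p ys = young_diagram ys - del"
    by (simp add: J_diagram_def del_def)
  moreover have "finite del"
    using calculation(2) finite_young_diagram by (rule finite_subset)
  ultimately have "card (J_diagram p ys) = card (young_diagram ys) - removal_count p ys"
    "removal_count p ys \<le> card (young_diagram ys)"
    using card_Diff_subset[of del "young_diagram ys"]
      card_mono[OF finite_young_diagram, of del ys] by simp_all
  then show ?thesis
    by (simp add: j_fun_def)
qed

section \<open>Inverting the deletion of row ends\<close>

text \<open>
  The passage from \<open>\<lambda>\<close> to \<open>J(\<lambda>)\<close>. The number of rows is kept, so rows of length 1 may become
  zero entries.
\<close>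

fun remove_ends :: "nat \<Rightarrow> nat list \<Rightarrow> nat list" where
  "remove_ends p [] = []"
| "remove_ends p (x # xs) =
     (if p dvd x + removal_count p xs then x else x - 1) # remove_ends p xs"

text \<open>
  The inverse passage, from the longest row downwards. Here \<open>k\<close> counts the shortened rows among
  the current one and those below it. If a row of length \<open>x\<close> with \<open>e\<close> shortened rows below it becomes
  \<open>x'\<close>, and \<open>e'\<close> also takes the row itself into account, then \<open>x' + e' = x + e\<close>.
  So the divisibility criterion can be read off from \<open>x'\<close> and \<open>e'\<close>.
\<close>

fun restore_ends :: "nat \<Rightarrow> nat \<Rightarrow> nat list \<Rightarrow> nat list" where
  "restore_ends p k [] = []"
| "restore_ends p k (x # xs) =
     (if p dvd x + k then x # restore_ends p k xs
      else Suc x # restore_ends p (k - 1) xs)"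

text \<open>
  Counting upwards through a row of shortened length \<open>x\<close> and restoring downwards through it form
  a Galois connection: both fix the \<open>k\<close> for which \<open>p\<close> divides \<open>x + k\<close> and move all others by
  one. The hypothesis excludes the truncated difference \<open>0 - 1\<close>.
\<close>

lemma step_adjoint:
  fixes p x j k :: nat
  assumes "p dvd x + k \<or> 0 < k"
  shows "j + of_bool (\<not> p dvd x + j) \<le> k \<longleftrightarrow> j \<le> k - of_bool (\<not> p dvd x + k)"
proof -
  have "j \<noteq> k" if "(p dvd x + j) \<noteq> (p dvd x + k)"
    using that by auto
  then show ?thesis
    using assms by (cases "p dvd x + j"; cases "p dvd x + k") auto
qed

text \<open>
  Counting commutes with the shift by \<open>p\<close>, so the adjunction transports not just lower bounds
  but windows of length \<open>p\<close>.
\<close>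

lemma step_window:
  fixes p x j k :: nat
  assumes "p dvd x + k \<or> 0 < k"
  shows "j + of_bool (\<not> p dvd x + j) \<le> k \<and> k < j + of_bool (\<not> p dvd x + j) + p \<longleftrightarrow>
    j \<le> k - of_bool (\<not> p dvd x + k) \<and> k - of_bool (\<not> p dvd x + k) < j + p"
proof -
  have "p dvd x + (j + p) \<longleftrightarrow> p dvd x + j"
    by (metis add.assoc dvd_add_triv_right_iff)
  then have "j + of_bool (\<not> p dvd x + j) + p \<le> k \<longleftrightarrow> j + p \<le> k - of_bool (\<not> p dvd x + k)"
    using step_adjoint[OF assms, of "j + p"] by (simp only: ac_simps)
  then show ?thesis
    by (simp only: step_adjoint[OF assms] not_le[symmetric])
qed

lemma length_remove_ends [simp]: "length (remove_ends p xs) = length xs"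
  by (induction xs) auto

lemma length_restore_ends [simp]: "length (restore_ends p k xs) = length xs"
  by (induction xs arbitrary: k) auto

lemma sum_remove_ends:
  "decreasing xs \<Longrightarrow> sum_list (remove_ends p xs) + removal_count p xs = sum_list xs"
proof (induction xs)
  case (Cons x xs)
  then show ?case
    using removed_end_positive[of x xs p] by auto
qed simp

text \<open>
  Among rows of equal length the shortened ones are the lowest: if a row keeps its end, then so
  does every row of the same length above it.
\<close>

lemma decreasing_remove_ends:
  "decreasing xs \<Longrightarrow> decreasing (remove_ends p xs)"
proof (induction xs)
  case (Cons x xs)
  have "first_part (remove_ends p xs) \<le> (if p dvd x + removal_count p xs then x else x - 1)"
  proof (cases xs)
    case (Cons y ys)
    then show ?thesis
      using Cons.prems by (cases "x = y") auto
  qed simp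
  then show ?case
    using Cons by simp
qed simp

lemma restore_remove_ends:
  "decreasing xs \<Longrightarrow> restore_ends p (removal_count p xs) (remove_ends p xs) = xs"
proof (induction xs)
  case (Cons x xs)
  then show ?case
    using removed_end_positive[of x xs p] by auto
qed simp

text \<open>
  At the bottom of the diagram the count is 0, which lies in the window \<open>[0, p)\<close>. Row by row this
  becomes a window of length \<open>p\<close> that starts at the count of the shortened diagram.
\<close>

lemma remove_ends_window:
  assumes "0 < p" "decreasing xs"
  shows "removal_count p (remove_ends p xs) \<le> removal_count p xs \<and>
    removal_count p xs < removal_count p (remove_ends p xs) + p"
  using assms(2)
proof (induction xs)
  case (Cons x xs)
  let ?x = "if p dvd x + removal_count p xs then x else x - 1"
  have eq: "?x + removal_count p (x # xs) = x + removal_count p xs"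
    using Cons.prems removed_end_positive[of x xs p] by auto
  have "removal_count p (x # xs) - of_bool (\<not> p dvd ?x + removal_count p (x # xs))
      = removal_count p xs"
    unfolding eq by simp
  moreover have "p dvd ?x + removal_count p (x # xs) \<or> 0 < removal_count p (x # xs)"
    unfolding eq by auto
  ultimately show ?case
    using step_window[of p ?x "removal_count p (x # xs)" "removal_count p (remove_ends p xs)"]
      Cons by (simp only: remove_ends.simps removal_count.simps(2) decreasing_Cons) 
qed (use assms in simp)

text \<open>
  Conversely, a \<open>k\<close> in the window leaves a remainder below \<open>p\<close> when the zero entries are
  reached. Each of these turns into a row of length 1 and lowers the remainder by one; the size
  bound ensures that there are enough of them to bring it down to 0.
\<close>

lemma restore_ends_inverse:
  assumes "decreasing xs" "removal_count p xs \<le> k" "k < removal_count p xs + p"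
    and "sum_list xs + k \<le> length xs"
  shows "removal_count p (restore_ends p k xs) = k \<and>
    remove_ends p (restore_ends p k xs) = xs \<and>
    decreasing (restore_ends p k xs) \<and> sum_list (restore_ends p k xs) = sum_list xs + k"
  using assms
proof (induction xs arbitrary: k)
  case (Cons x xs)
  define k' where "k' = k - of_bool (\<not> p dvd x + k)"
  have dec: "decreasing xs" "first_part xs \<le> x"
    using Cons.prems(1) by auto
  have pos: "p dvd x + k \<or> 0 < k"
    using Cons.prems(2) by (cases "k = 0") auto
  have "removal_count p xs \<le> k' \<and> k' < removal_count p xs + p"
    unfolding k'_def step_window[OF pos, symmetric]
    using Cons.prems(2,3) by (simp only: removal_count.simps simp_thms)
  then have window: "removal_count p xs \<le> k'" "k' < removal_count p xs + p"
    by blast+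
  have "sum_list xs + k' \<le> length xs"
  proof (cases "x = 0")
    case True
    then have zero: "removal_count p xs = 0" "sum_list xs = 0"
      using dec removal_count_zeros[of xs] by simp_all
    show ?thesis
    proof (cases "p dvd x + k")
      case True
      then have "p dvd k'" "k' < p"
        using \<open>x = 0\<close> window(2) zero by (auto simp: k'_def)
      \<comment> \<open>At a zero entry the restoration can only be stuck at a multiple of \<open>p\<close>, which is 0.\<close>
      then have "k' = 0"
        using nat_dvd_not_less by blast
      then show ?thesis
        using zero(2) by linarith
    next
      case False
      then show ?thesis
        using zero(2) Cons.prems(4) \<open>x = 0\<close> by (simp add: k'_def del: sum_list_eq_0_iff)
    qed
  next
    case False
    then show ?thesis
      using Cons.prems(4) by (simp add: k'_def)
  qed
  note IH = Cons.IH[OF dec(1) window this]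
  have first: "first_part (restore_ends p k' xs) \<le> x + of_bool (\<not> p dvd x + k)"
  proof (cases xs)
    case (Cons y ys)
    show ?thesis
    proof (cases "p dvd x + k")
      case True
      then show ?thesis
        using dec(2) Cons by (cases "x = y") (simp_all add: k'_def)
    next
      case False
      then show ?thesis
        using dec(2) Cons by simp
    qed
  qed simp
  show ?case
  proof (cases "p dvd x + k")
    case True
    then have "k' = k"
      by (simp add: k'_def)
    then show ?thesis
      using True IH first by simp
  next
    case False
    then have k: "k' = k - 1" "Suc (x + k') = x + k"
      using pos by (simp_all add: k'_def)
    then show ?thesis
      using False IH first pos by simp
  qed
qed simp

lemma remove_ends_fixed:
  "decreasing xs \<Longrightarrow> removal_count p xs = 0 \<Longrightarrow> remove_ends p xs = xs"
  by (induction xs) auto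

section \<open>Iterating the deletion of row ends\<close>

text \<open>
  The conjugates of the \<open>p\<close>-regular partitions. The last entry, too, is less than \<open>p\<close>, because
  it is compared with the default value 0.
\<close>

fun restricted :: "nat \<Rightarrow> nat list \<Rightarrow> bool" where
  "restricted p [] \<longleftrightarrow> True"
| "restricted p (x # xs) \<longleftrightarrow> first_part xs \<le> x \<and> x < first_part xs + p \<and> restricted p xs"

lemma restricted_imp_decreasing: "restricted p xs \<Longrightarrow> decreasing xs"
  by (induction xs) auto

text \<open>
  Inverts the iteration of \<open>J\<close>: \<open>p\<close> times \<open>es\<close> is where the iteration becomes stationary, and
  \<open>zs\<close> lists the numbers of nodes deleted in the single steps, the first step coming first.
\<close>

definition assemble :: "nat \<Rightarrow> nat list \<Rightarrow> nat list \<Rightarrow> nat list" where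
  "assemble p zs es = foldr (restore_ends p) zs (map ((*) p) es)"

lemma assemble_simps [simp]:
  "assemble p [] es = map ((*) p) es"
  "assemble p (z # zs) es = restore_ends p z (assemble p zs es)"
  by (simp_all add: assemble_def)

lemma decreasing_map_times: "decreasing es \<Longrightarrow> decreasing (map ((*) p) es)"
  by (auto simp: sorted_wrt_map intro: sorted_wrt_mono_rel[rotated])

text \<open>
  Restrictedness of \<open>zs\<close> is the window condition for consecutive numbers of deletions.
  The size condition leaves room for the rows that are created; when \<open>zs\<close> is zero, none are.
\<close>

lemma assemble_properties:
  assumes "restricted p zs" "decreasing es"
    and "first_part zs = 0 \<or> sum_list zs + p * sum_list es \<le> length es"
  shows "length (assemble p zs es) = length es \<and> decreasing (assemble p zs es) \<and>
    sum_list (assemble p zs es) = sum_list zs + p * sum_list es \<and>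
    removal_count p (assemble p zs es) = first_part zs \<and>
    remove_ends p (assemble p zs es) = assemble p (tl zs) es"
  using assms
proof (induction zs)
  case Nil
  have "removal_count p (map ((*) p) es) = 0"
    by (simp add: removal_count_eq_0_iff)
  moreover have "sum_list (map ((*) p) es) = p * sum_list es"
    by (simp add: sum_list_const_mult)
  moreover note decreasing_map_times[OF Nil.prems(2), of p]
  ultimately show ?case
    by (simp add: remove_ends_fixed)
next
  case (Cons z zs)
  let ?a = "assemble p zs es"
  have IH: "length ?a = length es" "decreasing ?a"
      "sum_list ?a = sum_list zs + p * sum_list es" "removal_count p ?a = first_part zs"
    using Cons by auto
  show ?case
  proof (cases "z = 0")
    case True
    then have "removal_count p ?a = 0"
      using IH(4) Cons.prems(1) by simp
    moreover from this have "restore_ends p 0 ?a = ?a"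
      using restore_remove_ends[OF IH(2), of p] remove_ends_fixed[OF IH(2)] by simp
    ultimately show ?thesis
      using True IH remove_ends_fixed[OF IH(2)] by auto
  next
    case False
    have "sum_list ?a + z \<le> length ?a"
      using False Cons.prems(3) IH by auto
    then show ?thesis
      using restore_ends_inverse[OF IH(2), of p z] IH Cons.prems(1) by auto
  qed
qed

text \<open>
  The list \<open>zs\<close> is recovered by applying \<open>J\<close> repeatedly and recording the numbers of deletions.
\<close>

lemma assemble_inject:
  assumes "assemble p zs es = assemble p zs' es'" "length zs = length zs'" "0 < p"
    and "restricted p zs" "decreasing es"
      "first_part zs = 0 \<or> sum_list zs + p * sum_list es \<le> length es"
    and "restricted p zs'" "decreasing es'"
      "first_part zs' = 0 \<or> sum_list zs' + p * sum_list es' \<le> length es'"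
  shows "zs = zs' \<and> es = es'"
  using assms(2) assms
proof (induction zs zs' rule: list_induct2)
  case Nil
  then show ?case
    by (auto simp: inj_map_eq_map inj_on_def)
next
  case (Cons z zs z' zs')
  have "removal_count p (assemble p (z # zs) es) = z"
      "remove_ends p (assemble p (z # zs) es) = assemble p zs es"
    using assemble_properties[OF Cons.prems(4-6)] by (simp_all only: first_part.simps list.sel)
  moreover have "removal_count p (assemble p (z' # zs') es') = z'"
      "remove_ends p (assemble p (z' # zs') es') = assemble p zs' es'"
    using assemble_properties[OF Cons.prems(7-9)] by (simp_all only: first_part.simps list.sel)
  ultimately have "z = z'" "assemble p zs es = assemble p zs' es'"
    using Cons.prems(1) by (simp_all only:)
  from this(2) have "zs = zs' \<and> es = es'"
  proof (rule Cons.IH)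
    show "first_part zs = 0 \<or> sum_list zs + p * sum_list es \<le> length es"
      using Cons.prems(4,6) by auto
    show "first_part zs' = 0 \<or> sum_list zs' + p * sum_list es' \<le> length es'"
      using Cons.prems(7,9) by auto
  qed (use Cons.prems Cons.hyps in simp_all)
  then show ?case
    using \<open>z = z'\<close> by simp
qed

text \<open>
  As long as something is deleted the size drops, so after at most \<open>L\<close> steps a diagram is reached
  in which nothing is deleted. Its parts are all divisible by \<open>p\<close>. Further steps contribute zeros.
\<close>

lemma assemble_exists:
  assumes "0 < p" "decreasing ys" "removal_count p ys = 0 \<or> sum_list ys \<le> length ys"
    and "removal_count p ys = 0 \<or> sum_list ys \<le> L"
  obtains zs es where "length zs = L" "restricted p zs" "decreasing es"
    "first_part zs = 0 \<or> sum_list zs + p * sum_list es \<le> length es"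
    "length es = length ys" "assemble p zs es = ys"
proof -
  have "\<exists>zs es. length zs = L \<and> restricted p zs \<and> decreasing es \<and>
    (first_part zs = 0 \<or> sum_list zs + p * sum_list es \<le> length es) \<and>
    length es = length ys \<and> assemble p zs es = ys"
    using assms(2-4)
  proof (induction L arbitrary: ys)
    case 0
    have "removal_count p ys = 0"
      using 0 by (auto simp: removal_count_eq_0_iff)
    then have "map ((*) p) (map (\<lambda>y. y div p) ys) = ys"
      by (auto simp: removal_count_eq_0_iff intro!: map_idI)
    moreover have "decreasing (map (\<lambda>y. y div p) ys)"
      using 0(1) by (auto simp: sorted_wrt_map intro: div_le_mono sorted_wrt_mono_rel[rotated])
    ultimately show ?case
      by (intro exI[of _ "[]"] exI[of _ "map (\<lambda>y. y div p) ys"]) (simp del: map_map)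
  next
    case (Suc L)
    let ?b = "remove_ends p ys"
    note sum = sum_remove_ends[OF Suc.prems(1), of p]
    note win = remove_ends_window[OF assms(1) Suc.prems(1)]
    have "removal_count p ?b = 0 \<or> sum_list ?b \<le> length ?b"
      using Suc.prems(2) sum win by auto
    moreover have "removal_count p ?b = 0 \<or> sum_list ?b \<le> L"
      using Suc.prems(3) sum win by (cases "removal_count p ys = 0") auto
    ultimately obtain zs es where ze: "length zs = L" "restricted p zs" "decreasing es"
      "first_part zs = 0 \<or> sum_list zs + p * sum_list es \<le> length es"
      "length es = length ?b" "assemble p zs es = ?b"
      using Suc.IH[OF decreasing_remove_ends[OF Suc.prems(1)]] by blast
    let ?z = "removal_count p ys # zs"
    have f: "removal_count p ?b = first_part zs" "sum_list ?b = sum_list zs + p * sum_list es"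
      using assemble_properties[OF ze(2-4)] ze(6) by auto
    have "restricted p ?z"
      using ze(2) win f by simp
    moreover have "first_part ?z = 0 \<or> sum_list ?z + p * sum_list es \<le> length es"
      using Suc.prems(2) sum f ze(5) by auto
    moreover have "assemble p ?z es = ys"
      using ze(6) restore_remove_ends[OF Suc.prems(1)] by simp
    ultimately show ?case
      using ze by (intro exI[of _ ?z] exI[of _ es]) simp
  qed
  then show thesis
    using that by blast
qed

section \<open>Restricted partitions as conjugates of regular ones\<close>

text \<open>
  Putting a row of length \<open>x\<close> on top of a diagram lengthens its columns by one and adds new
  columns of length 1. Only columns of positive length are listed, so trailing zeros of the
  argument have no effect.
\<close>

fun conjugate :: "nat list \<Rightarrow> nat list" where
  "conjugate [] = []"
| "conjugate (x # xs) = map Suc (conjugate xs) @ replicate (x - first_part xs) 1"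

lemma count_list_map_Suc:
  "count_list (map Suc xs) k = (if k = 0 then 0 else count_list xs (k - 1))"
  by (induction xs) auto

lemma count_list_replicate: "count_list (replicate n x) k = (if k = x then n else 0)"
  by (induction n) auto

lemma sum_list_map_Suc: "sum_list (map Suc xs) = sum_list xs + length xs"
  by (induction xs) auto

text \<open>
  The multiplicity of a part of the conjugate is a difference of consecutive entries, which turns
  the restrictedness condition into regularity.
\<close>

lemma conjugate_properties:
  assumes "0 < p" "restricted p xs"
  shows "length (conjugate xs) = first_part xs" "sum_list (conjugate xs) = sum_list xs"
    "decreasing (conjugate xs)" "0 \<notin> set (conjugate xs)"
    "\<forall>k>0. count_list (conjugate xs) k < p"
  using assms(2)
proof (induction xs)
  case (Cons x xs)
  {
    case 1
    then show ?case using Cons by simp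
  next
    case 2
    then show ?case using Cons by (simp add: sum_list_map_Suc sum_list_replicate)
  next
    case 3
    have "decreasing (replicate n (1::nat))" for n
      by (induction n) (auto simp: sorted_wrt.simps(2) simp del: decreasing_Cons)
    then show ?case using 3 Cons by (auto simp: sorted_wrt_append sorted_wrt_map)
  next
    case 4
    then show ?case by auto
  next
    case 5
    have "count_list (conjugate xs) 0 = 0"
      using 5 Cons(4) by (simp add: count_list_0_iff)
    then show ?case
      using 5 Cons(5) by (auto simp: count_list_map_Suc count_list_replicate)
  }
qed (use assms(1) in auto)

lemma conjugate_inject:
  assumes "0 < p" "length xs = length ys" "restricted p xs" "restricted p ys"
    and "conjugate xs = conjugate ys"
  shows "xs = ys"
  using assms(2-5)
proof (induction xs ys rule: list_induct2)
  case (Cons x xs y ys)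
  have "x = y"
    using conjugate_properties(1)[OF assms(1) Cons.prems(1)]
      conjugate_properties(1)[OF assms(1) Cons.prems(2)] Cons.prems(3)
    by (metis first_part.simps(2))
  have "filter (\<lambda>k. 1 < k) (conjugate (z # zs)) = map Suc (conjugate zs)"
    if "restricted p (z # zs)" for z zs
  proof -
    have "0 \<notin> set (conjugate zs)"
      using that conjugate_properties(4)[OF assms(1)] by simp
    then have "filter (\<lambda>k. 1 < k) (map Suc (conjugate zs)) = map Suc (conjugate zs)"
      by (auto simp: filter_id_conv intro: gr0I)
    then show ?thesis by simp
  qed
  then have "map Suc (conjugate xs) = map Suc (conjugate ys)"
    using Cons.prems by metis
  then have "conjugate xs = conjugate ys"
    by (simp add: inj_map_eq_map)
  then show ?case
    using Cons.IH Cons.prems \<open>x = y\<close> by simp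
qed simp

text \<open>
  The parts 1 of the conjugate come from the topmost row; splitting them off is the step of the
  induction that reconstructs the rows.
\<close>

lemma decreasing_split_ones:
  assumes "decreasing ls" "0 \<notin> set ls"
  shows "ls = filter (\<lambda>x. 1 < x) ls @ replicate (count_list ls 1) 1"
  using assms
proof (induction ls)
  case (Cons x ls)
  show ?case
  proof (cases "1 < x")
    case True
    then show ?thesis using Cons by simp
  next
    case False
    then have "x = 1" using Cons.prems(2) by (cases x) auto
    have "filter (\<lambda>x. 1 < x) ls = []"
      using Cons.prems(1) \<open>x = 1\<close>
      by (auto simp: filter_empty_conv sorted_wrt.simps(2) simp del: decreasing_Cons)
    then show ?thesis using Cons \<open>x = 1\<close> by simp
  qed
qed simp

lemma conjugate_exists:
  assumes "decreasing ls" "0 \<notin> set ls" "\<forall>k>0. count_list ls k < p" "\<forall>x\<in>set ls. x \<le> N" "0 < p"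
  shows "\<exists>xs. length xs = N \<and> restricted p xs \<and> conjugate xs = ls"
  using assms(1-4)
proof (induction N arbitrary: ls)
  case 0
  then have "ls = []" by (cases ls) auto
  then show ?case by simp
next
  case (Suc N)
  let ?ls = "map (\<lambda>x. x - 1) (filter (\<lambda>x. 1 < x) ls)"
  have "count_list ?ls k = count_list ls (Suc k)" if "0 < k" for k
    using that by (induction ls) auto
  then have "\<forall>k>0. count_list ?ls k < p"
    using Suc.prems(3) by simp
  moreover have "decreasing ?ls"
    using sorted_wrt_filter[OF Suc.prems(1), of "\<lambda>x. 1 < x"]
    by (auto simp: sorted_wrt_map elim!: sorted_wrt_mono_rel[rotated])
  moreover have "0 \<notin> set ?ls" "\<forall>x\<in>set ?ls. x \<le> N"
    using Suc.prems(4) by auto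
  ultimately obtain xs where xs: "length xs = N" "restricted p xs" "conjugate xs = ?ls"
    using Suc.IH[of ?ls] by blast
  have len: "length ls = length ?ls + count_list ls 1"
    using arg_cong[OF decreasing_split_ones[OF Suc.prems(1,2)], of length] by simp
  have fp: "first_part xs = length ?ls"
    using conjugate_properties(1)[OF assms(5) xs(2)] xs(3) by simp
  have "restricted p (length ls # xs)"
    using xs(2) fp len Suc.prems(3) by simp
  moreover have "map Suc ?ls = filter (\<lambda>x. 1 < x) ls"
    by (auto intro!: map_idI)
  then have "conjugate (length ls # xs) = ls"
    using xs(3) fp len decreasing_split_ones[OF Suc.prems(1,2)] by simp
  ultimately show ?case
    using xs(1) by (intro exI[of _ "length ls # xs"]) simp
qed

lemma bij_betw_conjugate:
  assumes "0 < p" "a \<le> N"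
  shows "bij_betw conjugate {xs. length xs = N \<and> restricted p xs \<and> sum_list xs = a}
    (l_regular_partitions p a)"
proof (rule bij_betw_imageI)
  show "inj_on conjugate {xs. length xs = N \<and> restricted p xs \<and> sum_list xs = a}"
    using conjugate_inject[OF assms(1)] by (auto intro!: inj_onI)
  show "conjugate ` {xs. length xs = N \<and> restricted p xs \<and> sum_list xs = a}
      = l_regular_partitions p a" (is "?L = ?R")
  proof (intro equalityI subsetI)
    fix ls assume "ls \<in> ?L"
    then show "ls \<in> ?R"
      using conjugate_properties[OF assms(1)]
      by (auto simp: l_regular_partitions_def partitions_of_def)
  next
    fix ls assume "ls \<in> ?R"
    then have ls: "decreasing ls" "0 \<notin> set ls" "sum_list ls = a" "\<forall>k>0. count_list ls k < p"
      by (auto simp: l_regular_partitions_def partitions_of_def)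
    moreover have "\<forall>x\<in>set ls. x \<le> N"
      using member_le_sum_list ls(3) assms(2) by fastforce
    ultimately obtain xs where "length xs = N" "restricted p xs" "conjugate xs = ls"
      using conjugate_exists[of ls p N] assms(1) by blast
    then show "ls \<in> ?L"
      using conjugate_properties(2)[OF assms(1)] ls(3) by auto
  qed
qed

section \<open>Division of differences by \<open>p\<close>\<close>

fun add_multiple :: "nat \<Rightarrow> nat list \<Rightarrow> nat list \<Rightarrow> nat list" where
  "add_multiple p (x # xs) (y # ys) = (y + p * x) # add_multiple p xs ys"
| "add_multiple p _ ys = ys"

lemma add_multiple_properties:
  assumes "decreasing xs" "restricted p ys" "length xs \<le> length ys"
  shows "length (add_multiple p xs ys) = length ys"
    "first_part (add_multiple p xs ys) = first_part ys + p * first_part xs"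
    "decreasing (add_multiple p xs ys)"
    "sum_list (add_multiple p xs ys) = sum_list ys + p * sum_list xs"
    "restricted p (drop (length xs) (add_multiple p xs ys))"
  using assms
proof (induction p xs ys rule: add_multiple.induct)
  case (1 p x xs y ys)
  {
    case 1 then show ?case using "1.IH" by simp
  next
    case 2 then show ?case by simp
  next
    case 3 then show ?case using "1.IH" by (simp add: add_mono)
  next
    case 4 then show ?case using "1.IH" by (simp add: algebra_simps)
  next
    case 5 then show ?case using "1.IH" by simp
  }
qed (auto intro: restricted_imp_decreasing)

text \<open>
  From the last entry upwards, the difference of neighbouring entries determines its remainder
  (from \<open>ys\<close>) and its quotient (from \<open>xs\<close>) on division by \<open>p\<close>. The existence proof below
  reads off both parts in the same way.
\<close>

lemma add_multiple_inject:
  assumes "add_multiple p xs ys = add_multiple p xs' ys'"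
    and "length xs = length xs'" "length ys = length ys'" "length xs \<le> length ys"
    and "restricted p ys" "restricted p ys'"
  shows "xs = xs' \<and> ys = ys'"
  using assms(2) assms
proof (induction xs xs' arbitrary: ys ys' rule: list_induct2)
  case (Cons x xs x' xs')
  obtain y zs y' zs' where yz: "ys = y # zs" "ys' = y' # zs'"
    using Cons.prems(3,4) by (cases ys; cases ys') auto
  have eq: "xs = xs' \<and> zs = zs'"
    using Cons.prems yz by (intro Cons.IH) auto
  have heads: "y + p * x = y' + p * x'"
    using Cons.prems(1) yz by simp
  obtain d where d: "y = first_part zs + d" "d < p"
    using Cons.prems(5) yz by (metis add_less_cancel_left le_iff_add restricted.simps(2))
  obtain d' where d': "y' = first_part zs + d'" "d' < p"
    using Cons.prems(6) yz eq by (metis add_less_cancel_left le_iff_add restricted.simps(2))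
  have "d + p * x = d' + p * x'"
    using heads d d' by simp
  then have "(d + p * x) mod p = (d' + p * x') mod p" "(d + p * x) div p = (d' + p * x') div p"
    by simp_all
  then show ?case
    using d d' eq yz by simp
qed auto

lemma add_multiple_exists:
  assumes "decreasing zs" "0 < p" "m \<le> length zs" "restricted p (drop m zs)"
  shows "\<exists>xs ys. length xs = m \<and> decreasing xs \<and> length ys = length zs \<and> restricted p ys \<and>
    add_multiple p xs ys = zs"
  using assms(1,3,4)
proof (induction m arbitrary: zs)
  case 0
  then show ?case by (intro exI[of _ "[]"] exI[of _ zs]) simp
next
  case (Suc m)
  then obtain a ws where zs: "zs = a # ws"
    by (cases zs) auto
  then obtain xs ys where IH: "length xs = m" "decreasing xs" "length ys = length ws"
      "restricted p ys" "add_multiple p xs ys = ws"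
    using Suc.IH[of ws] Suc.prems by auto
  define d where "d = a - first_part ws"
  have "first_part ws = first_part ys + p * first_part xs"
    using add_multiple_properties(2)[of xs p ys] IH Suc.prems(2) zs by simp
  then have a: "a = first_part ys + p * first_part xs + d"
    using Suc.prems(1) zs by (simp add: d_def)
  have "first_part ys + d mod p + p * (first_part xs + d div p) = a"
    unfolding a by (simp add: algebra_simps)
  then show ?case
    using IH zs assms(2)
    by (intro exI[of _ "(first_part xs + d div p) # xs"] exI[of _ "(first_part ys + d mod p) # ys"])
      simp
qed

section \<open>The index set\<close>

text \<open>
  Partitions with at most \<open>N\<close> parts are lists of length \<open>N\<close>, once the zeros are dropped.
\<close>

lemma decreasing_split_zeros:
  assumes "decreasing xs"
  shows "xs = filter (\<lambda>x. 0 < x) xs @ replicate (length xs - length (filter (\<lambda>x. 0 < x) xs)) 0"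
  using assms
proof (induction xs)
  case (Cons x xs)
  show ?case
  proof (cases "0 < x")
    case True
    then show ?thesis using Cons by simp
  next
    case False
    then have "\<forall>y\<in>set (x # xs). y = 0"
      using Cons.prems by (auto simp: sorted_wrt.simps(2) simp del: decreasing_Cons)
    then have "filter (\<lambda>x. 0 < x) (x # xs) = []" "x # xs = replicate (length (x # xs)) 0"
      by (auto simp: filter_empty_conv replicate_length_same)
    then show ?thesis by simp
  qed
qed simp

lemma sum_list_filter_positive: "sum_list (filter (\<lambda>x. 0 < x) xs) = sum_list (xs :: nat list)"
  by (induction xs) auto

lemma bij_betw_drop_zeros:
  "bij_betw (filter (\<lambda>x. 0 < x)) {xs. length xs = N \<and> decreasing xs \<and> sum_list xs = a}
    (bounded_partitions N a)"
proof (rule bij_betw_byWitness[where f' = "\<lambda>xs. xs @ replicate (N - length xs) 0"])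
  show "\<forall>xs\<in>{xs. length xs = N \<and> decreasing xs \<and> sum_list xs = a}.
      filter (\<lambda>x. 0 < x) xs @ replicate (N - length (filter (\<lambda>x. 0 < x) xs)) 0 = xs"
    using decreasing_split_zeros by auto
  show "\<forall>xs\<in>bounded_partitions N a.
      filter (\<lambda>x. 0 < x) (xs @ replicate (N - length xs) 0) = xs"
    by (auto simp: bounded_partitions_def partitions_of_def filter_id_conv intro: gr0I)
  show "filter (\<lambda>x. 0 < x) ` {xs. length xs = N \<and> decreasing xs \<and> sum_list xs = a}
      \<subseteq> bounded_partitions N a"
    by (auto simp: bounded_partitions_def partitions_of_def sum_list_filter_positive
        sorted_wrt_filter)
  have "decreasing (replicate k (0::nat))" for k
    by (induction k) (auto simp: sorted_wrt.simps(2) simp del: decreasing_Cons)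
  then show "(\<lambda>xs. xs @ replicate (N - length xs) 0) ` bounded_partitions N a
      \<subseteq> {xs. length xs = N \<and> decreasing xs \<and> sum_list xs = a}"
    by (auto simp: bounded_partitions_def partitions_of_def sorted_wrt_append sum_list_replicate)
qed

text \<open>
  The index set with all partitions replaced by lists of fixed length, and the regular one by its
  conjugate.
\<close>

definition padded_index :: "nat \<Rightarrow> nat \<Rightarrow> nat \<Rightarrow> nat \<Rightarrow> (nat list \<times> nat list \<times> nat list) set" where
  "padded_index p m n r = {(ys, xi, eta). length ys = m + n \<and> restricted p ys \<and>
     length xi = m \<and> decreasing xi \<and> length eta = n \<and> decreasing eta \<and>
     sum_list ys + p * (sum_list xi + sum_list eta) = r}"

text \<open>
  The summand \<open>r\<^sub>0 = 0\<close> of the index set consists of single partitions; they correspond to the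
  triples with two empty partitions.
\<close>

definition index_of_triple :: "nat list \<times> nat list \<times> nat list \<Rightarrow> P_index" where
  "index_of_triple t = (case t of (lam, xi, eta) \<Rightarrow>
     if xi = [] \<and> eta = [] then Inl lam else Inr t)"

lemma P_set_eq_index_of_triple:
  assumes "0 < p"
  shows "P_set p m n r = index_of_triple ` {(lam, xi, eta). \<exists>a b c. a + p * (b + c) = r \<and>
    lam \<in> l_regular_partitions p a \<and> xi \<in> bounded_partitions m b \<and> eta \<in> bounded_partitions n c}"
    (is "_ = index_of_triple ` ?U")
proof (intro equalityI subsetI)
  have empty: "[] \<in> bounded_partitions N b \<longleftrightarrow> b = 0" for N b
    by (auto simp: bounded_partitions_def partitions_of_def)
  have only_empty: "xs = []" if "xs \<in> bounded_partitions N 0" for xs N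
    using that by (cases xs) (auto simp: bounded_partitions_def partitions_of_def)
  {
    fix t assume "t \<in> P_set p m n r"
    then obtain a b where ab: "a + p * b = r" "t \<in> P_vec p m n r (a, b)"
      by (auto simp: P_set_def R_vecs_def)
    show "t \<in> index_of_triple ` ?U"
    proof (cases "b = 0")
      case True
      then obtain lam where "t = Inl lam" "lam \<in> l_regular_partitions p r"
        using ab by (auto simp: P_vec_def)
      then have "t = index_of_triple (lam, [], [])" "(lam, [], []) \<in> ?U"
        using empty by (auto simp: index_of_triple_def)
      then show ?thesis by blast
    next
      case False
      then obtain lam xi eta i where t: "t = Inr (lam, xi, eta)" "i \<le> b"
          "lam \<in> l_regular_partitions p a" "xi \<in> bounded_partitions m i"
          "eta \<in> bounded_partitions n (b - i)"
        using ab(2) by (auto simp: P_vec_def)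
      have "\<not> (xi = [] \<and> eta = [])"
        using t(2,4,5) False empty by auto
      then have "t = index_of_triple (lam, xi, eta)"
        using t(1) by (auto simp: index_of_triple_def)
      moreover have "a + p * (i + (b - i)) = r"
        using t(2) ab(1) by simp
      then have "(lam, xi, eta) \<in> ?U"
        using t(3-5) \<open>a + p * (i + (b - i)) = r\<close> by blast
      ultimately show ?thesis by blast
    qed
  next
    fix t assume "t \<in> index_of_triple ` ?U"
    then obtain lam xi eta a b c where t: "t = index_of_triple (lam, xi, eta)"
        "a + p * (b + c) = r" "lam \<in> l_regular_partitions p a"
        "xi \<in> bounded_partitions m b" "eta \<in> bounded_partitions n c"
      by auto
    have "(a, b + c) \<in> R_vecs p r"
      using t(2) by (simp add: R_vecs_def)
    moreover have "t \<in> P_vec p m n r (a, b + c)"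
    proof (cases "b + c = 0")
      case True
      then show ?thesis
        using t only_empty by (auto simp: P_vec_def index_of_triple_def)
    next
      case False
      then have "\<not> (xi = [] \<and> eta = [])"
        using t(4,5) empty by auto
      then have eq: "t = Inr (lam, xi, eta)"
        using t(1) by (auto simp: index_of_triple_def)
      show ?thesis
        unfolding P_vec_def eq snd_conv fst_conv if_not_P[OF False]
        by (intro imageI UN_I[of b]) (use t(3-5) in auto)
    qed
    ultimately show "t \<in> P_set p m n r"
      by (auto simp: P_set_def)
  }
qed

text \<open>
  The regular partition has size at most \<open>r \<le> m + n\<close>, so its parts are at most \<open>m + n\<close> and its
  conjugate fits into \<open>m + n\<close> rows.
\<close>

lemma bij_betw_padded_index_P_set:
  assumes "0 < p" "r \<le> m + n"
  shows "bij_betw (\<lambda>(ys, xi, eta). index_of_triple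
      (conjugate ys, filter (\<lambda>x. 0 < x) xi, filter (\<lambda>x. 0 < x) eta))
    (padded_index p m n r) (P_set p m n r)"
proof -
  let ?pos = "filter (\<lambda>x. 0 < (x::nat))"
  let ?U = "{(lam, xi, eta). \<exists>a b c. a + p * (b + c) = r \<and> lam \<in> l_regular_partitions p a \<and>
    xi \<in> bounded_partitions m b \<and> eta \<in> bounded_partitions n c}"
  have inj_pos: "xs = xs'" if "?pos xs = ?pos xs'" "length xs = length xs'"
      "decreasing xs" "decreasing xs'" for xs xs'
    using that decreasing_split_zeros by metis
  have "bij_betw (\<lambda>(ys, xi, eta). (conjugate ys, ?pos xi, ?pos eta)) (padded_index p m n r) ?U"
  proof (rule bij_betw_imageI)
    show "inj_on (\<lambda>(ys, xi, eta). (conjugate ys, ?pos xi, ?pos eta)) (padded_index p m n r)"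
      by (auto simp: padded_index_def intro!: inj_onI intro: inj_pos conjugate_inject[OF assms(1)])
    show "(\<lambda>(ys, xi, eta). (conjugate ys, ?pos xi, ?pos eta)) ` padded_index p m n r = ?U"
      (is "?f ` _ = _")
    proof (intro equalityI subsetI)
      fix t assume "t \<in> ?f ` padded_index p m n r"
      then obtain ys xi eta where t: "t = (conjugate ys, ?pos xi, ?pos eta)"
          "(ys, xi, eta) \<in> padded_index p m n r"
        by auto
      then have "sum_list ys \<le> m + n"
        using assms(2) by (auto simp: padded_index_def)
      then have "conjugate ys \<in> l_regular_partitions p (sum_list ys)"
        "?pos xi \<in> bounded_partitions m (sum_list xi)"
        "?pos eta \<in> bounded_partitions n (sum_list eta)"
        using t(2) bij_betwE[OF bij_betw_conjugate[OF assms(1)]] bij_betwE[OF bij_betw_drop_zeros]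
        by (auto simp: padded_index_def)
      then show "t \<in> ?U"
        using t by (auto simp: padded_index_def)
    next
      fix t assume "t \<in> ?U"
      then obtain lam xi eta a b c where t: "t = (lam, xi, eta)" "a + p * (b + c) = r"
          "lam \<in> l_regular_partitions p a" "xi \<in> bounded_partitions m b"
          "eta \<in> bounded_partitions n c"
        by auto
      have "a \<le> m + n"
        using t(2) assms(2) by simp
      then obtain ys where ys: "length ys = m + n" "restricted p ys" "sum_list ys = a"
          "lam = conjugate ys"
        using t(3) bij_betw_imp_surj_on[OF bij_betw_conjugate[OF assms(1)]] by blast
      obtain xi' where xi: "length xi' = m" "decreasing xi'" "sum_list xi' = b" "xi = ?pos xi'"
        using t(4) bij_betw_imp_surj_on[OF bij_betw_drop_zeros[of m b]] by blast
      obtain eta' where eta: "length eta' = n" "decreasing eta'" "sum_list eta' = c"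
          "eta = ?pos eta'"
        using t(5) bij_betw_imp_surj_on[OF bij_betw_drop_zeros[of n c]] by blast
      have "(ys, xi', eta') \<in> padded_index p m n r"
        using ys xi eta t(2) by (simp add: padded_index_def)
      then show "t \<in> ?f ` padded_index p m n r"
        using t(1) ys(4) xi(4) eta(4) by force
    qed
  qed
  moreover have "bij_betw index_of_triple ?U (P_set p m n r)"
    unfolding P_set_eq_index_of_triple[OF assms(1)]
    by (intro inj_on_imp_bij_betw inj_onI)
      (auto simp: index_of_triple_def split: prod.splits if_splits)
  ultimately have "bij_betw
      (index_of_triple \<circ> (\<lambda>(ys, xi, eta). (conjugate ys, ?pos xi, ?pos eta)))
      (padded_index p m n r) (P_set p m n r)"
    by (rule bij_betw_trans)
  then show ?thesis
    by (simp add: comp_def case_prod_unfold)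
qed

section \<open>The bijections\<close>

text \<open>
  The meeting point of the two sides. The first \<open>m\<close> differences of \<open>zs\<close> are arbitrary: they
  can be reduced modulo \<open>p\<close>, which yields \<open>\<xi>\<close>, or the first \<open>m\<close> entries can be split off,
  which yields \<open>\<lambda>\<^sup>(\<^sup>0\<^sup>)\<close>.
\<close>

definition partly_restricted :: "nat \<Rightarrow> nat \<Rightarrow> nat \<Rightarrow> nat \<Rightarrow> (nat list \<times> nat list) set" where
  "partly_restricted p m n r = {(zs, eta). length zs = m + n \<and> decreasing zs \<and>
     restricted p (drop m zs) \<and> length eta = n \<and> decreasing eta \<and>
     sum_list zs + p * sum_list eta = r}"

lemma bij_betw_padded_index_partly_restricted:
  assumes "0 < p"
  shows "bij_betw (\<lambda>(ys, xi, eta). (add_multiple p xi ys, eta))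
    (padded_index p m n r) (partly_restricted p m n r)"
proof (rule bij_betw_imageI)
  show "inj_on (\<lambda>(ys, xi, eta). (add_multiple p xi ys, eta)) (padded_index p m n r)"
    by (rule inj_onI) (auto simp: padded_index_def dest: add_multiple_inject)
  show "(\<lambda>(ys, xi, eta). (add_multiple p xi ys, eta)) ` padded_index p m n r
      = partly_restricted p m n r" (is "?f ` _ = _")
  proof (intro equalityI subsetI)
    fix t assume "t \<in> ?f ` padded_index p m n r"
    then obtain ys xi eta where t: "t = (add_multiple p xi ys, eta)"
        "(ys, xi, eta) \<in> padded_index p m n r"
      by auto
    then have "decreasing xi" "restricted p ys" "length xi \<le> length ys"
      by (auto simp: padded_index_def)
    from add_multiple_properties[OF this] show "t \<in> partly_restricted p m n r"
      using t by (auto simp: padded_index_def partly_restricted_def algebra_simps)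
  next
    fix t assume "t \<in> partly_restricted p m n r"
    then obtain zs eta where t: "t = (zs, eta)" "length zs = m + n" "decreasing zs"
        "restricted p (drop m zs)" "length eta = n" "decreasing eta"
        "sum_list zs + p * sum_list eta = r"
      by (auto simp: partly_restricted_def)
    then obtain xi ys where xy: "length xi = m" "decreasing xi" "length ys = m + n"
        "restricted p ys" "add_multiple p xi ys = zs"
      using add_multiple_exists[of zs p m] assms by auto
    have "sum_list zs = sum_list ys + p * sum_list xi"
      using add_multiple_properties(4)[OF xy(2,4)] xy by simp
    then have "(ys, xi, eta) \<in> padded_index p m n r"
      using xy t by (simp add: padded_index_def algebra_simps)
    then show "t \<in> ?f ` padded_index p m n r"
      using t(1) xy(5) by force
  qed
qed

text \<open>
  If the entries of \<open>\<lambda>\<^sup>(\<^sup>0\<^sup>)\<close> are positive, they use up at least \<open>m\<close> of the size \<open>r \<le> m + n\<close>, so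
  that at most \<open>n\<close> is left for \<open>\<lambda>\<^sup>(\<^sup>1\<^sup>)\<close>.
\<close>

lemma remaining_size_le:
  fixes xs :: "nat list"
  assumes "\<forall>x\<in>set xs. c \<le> x" "length xs = m" "sum_list xs + s \<le> m + n"
  shows "c = 0 \<or> s \<le> n"
proof (cases "c = 0")
  case False
  have "length xs * c \<le> sum_list xs"
    using assms(1) by (induction xs) auto
  moreover have "m \<le> m * c"
    using False by simp
  ultimately have "m \<le> sum_list xs"
    using assms(2) le_trans by blast
  then show ?thesis
    using assms(3) by simp
qed simp

text \<open>
  The restricted list obtained from \<open>\<lambda>\<^sup>(\<^sup>1\<^sup>)\<close> starts with \<open>j(\<lambda>\<^sup>(\<^sup>1\<^sup>))\<close>. Therefore the condition
  \<open>j(t(\<lambda>)) \<le> \<lambda>\<^sub>m\<close> says that appending it to \<open>\<lambda>\<^sup>(\<^sup>0\<^sup>)\<close> gives a decreasing list.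
\<close>

lemma bij_betw_partly_restricted_Lam_pp:
  assumes "0 < p" "1 \<le> m" "r \<le> m + n"
  shows "bij_betw (\<lambda>(zs, eta). (take m zs, assemble p (drop m zs) eta))
    (partly_restricted p m n r) (Lam_pp p m n r)"
proof -
  \<comment> \<open>The last conjunct is the hypothesis under which \<open>assemble\<close> has enough rows.\<close>
  have members: "\<exists>xs zs. rs = xs @ zs \<and> length xs = m \<and> length zs = n \<and>
      take m rs = xs \<and> drop m rs = zs \<and> decreasing xs \<and> restricted p zs \<and> decreasing eta \<and>
      (\<forall>x\<in>set xs. first_part zs \<le> x) \<and> length eta = n \<and>
      sum_list xs + (sum_list zs + p * sum_list eta) = r \<and>
      (first_part zs = 0 \<or> sum_list zs + p * sum_list eta \<le> length eta)"
    if "(rs, eta) \<in> partly_restricted p m n r" for rs eta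
  proof (intro exI conjI)
    have rs: "length rs = m + n" "decreasing (take m rs @ drop m rs)" "restricted p (drop m rs)"
      and eta: "length eta = n" "decreasing eta" "sum_list rs + p * sum_list eta = r"
      using that by (auto simp: partly_restricted_def)
    show "rs = take m rs @ drop m rs" by simp
    show "length (take m rs) = m" "length (drop m rs) = n"
      using rs by auto
    show "decreasing (take m rs)" "restricted p (drop m rs)"
      using rs by (auto simp: sorted_wrt_append)
    show bound: "\<forall>x\<in>set (take m rs). first_part (drop m rs) \<le> x"
      using rs(2) by (cases "drop m rs") (auto simp: sorted_wrt_append)
    have "sum_list rs = sum_list (take m rs) + sum_list (drop m rs)"
      by (metis append_take_drop_id sum_list_append)
    then show sum: "sum_list (take m rs) + (sum_list (drop m rs) + p * sum_list eta) = r"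
      using eta(3) by simp
    show "first_part (drop m rs) = 0 \<or>
        sum_list (drop m rs) + p * sum_list eta \<le> length eta"
      using remaining_size_le[OF bound, of m "sum_list (drop m rs) + p * sum_list eta" n]
        sum rs(1) eta(1) assms(3) by simp
  qed (use that in \<open>auto simp: partly_restricted_def\<close>)
  show ?thesis
  proof (rule bij_betw_imageI)
    show "inj_on (\<lambda>(zs, eta). (take m zs, assemble p (drop m zs) eta)) (partly_restricted p m n r)"
    proof (rule inj_onI, clarify)
      fix rs eta rs' eta'
      assume in1: "(rs, eta) \<in> partly_restricted p m n r"
        and in2: "(rs', eta') \<in> partly_restricted p m n r"
        and eq: "take m rs = take m rs'"
          "assemble p (drop m rs) eta = assemble p (drop m rs') eta'"
      have "drop m rs = drop m rs' \<and> eta = eta'"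
        using assemble_inject[OF eq(2) _ assms(1)] members[OF in1] members[OF in2] by auto
      then show "rs = rs' \<and> eta = eta'"
        using eq(1) by (metis append_take_drop_id)
    qed
    show "(\<lambda>(zs, eta). (take m zs, assemble p (drop m zs) eta)) ` partly_restricted p m n r
        = Lam_pp p m n r" (is "?f ` _ = _")
    proof (intro equalityI subsetI)
      fix t assume "t \<in> ?f ` partly_restricted p m n r"
      then obtain rs eta where t: "t = ?f (rs, eta)" "(rs, eta) \<in> partly_restricted p m n r"
        by auto
      obtain xs zs where z: "length xs = m" "take m rs = xs" "drop m rs = zs" "decreasing xs"
        "restricted p zs" "decreasing eta" "\<forall>x\<in>set xs. first_part zs \<le> x" "length eta = n"
        "sum_list xs + (sum_list zs + p * sum_list eta) = r"
        "first_part zs = 0 \<or> sum_list zs + p * sum_list eta \<le> length eta"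
        using members[OF t(2)] by blast
      note a = assemble_properties[OF z(5,6,10)]
      have "xs ! (m - 1) \<in> set xs"
        using z(1) assms(2) by simp
      then have "j_fun p (assemble p zs eta) \<le> xs ! (m - 1)"
        using j_fun_eq_removal_count[of "assemble p zs eta" p] a assms(1) z(7) by simp
      moreover have "t = (xs, assemble p zs eta)"
        using t(1) z(2,3) by simp
      ultimately show "t \<in> Lam_pp p m n r"
        using a z by (simp add: Lam_pp_def Lam_plus_def Lam_def)
    next
      fix t assume "t \<in> Lam_pp p m n r"
      then obtain xs ys where t: "t = (xs, ys)" "length xs = m" "length ys = n"
          "sum_list xs + sum_list ys = r" "decreasing xs" "decreasing ys"
          "j_fun p ys \<le> xs ! (m - 1)"
        by (auto simp: Lam_pp_def Lam_plus_def Lam_def)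
      have "xs ! (m - 1) \<le> x" if "x \<in> set xs" for x
      proof -
        obtain i where "i < m" "x = xs ! i"
          using \<open>x \<in> set xs\<close> t(2) by (metis in_set_conv_nth)
        then show ?thesis
          using sorted_wrt_nth_less[OF t(5), of i "m - 1"] t(2) by (cases "i = m - 1") auto
      qed
      then have bound: "\<forall>x\<in>set xs. removal_count p ys \<le> x"
        using j_fun_eq_removal_count[OF t(6) assms(1)] t(7) by (metis le_trans)
      have "removal_count p ys = 0 \<or> sum_list ys \<le> n"
        using remaining_size_le[OF bound t(2), of "sum_list ys" n] t(4) assms(3) by simp
      then obtain zs eta where z: "length zs = n" "restricted p zs" "decreasing eta"
          "first_part zs = 0 \<or> sum_list zs + p * sum_list eta \<le> length eta"
          "length eta = n" "assemble p zs eta = ys"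
        using assemble_exists[OF assms(1) t(6), of n] t(3) by metis
      note a = assemble_properties[OF z(2-4)]
      have "\<forall>z\<in>set zs. z \<le> first_part zs"
        using restricted_imp_decreasing[OF z(2)]
        by (cases zs) (auto simp: sorted_wrt.simps(2) simp del: decreasing_Cons)
      then have "\<forall>x\<in>set xs. \<forall>z\<in>set zs. z \<le> x"
        using bound a z(6) by fastforce
      then have "decreasing (xs @ zs)"
        using t(5) restricted_imp_decreasing[OF z(2)] by (simp add: sorted_wrt_append)
      then have "(xs @ zs, eta) \<in> partly_restricted p m n r"
        using t z a by (simp add: partly_restricted_def)
      moreover have "t = ?f (xs @ zs, eta)"
        using t(1,2) z(6) by simp
      ultimately show "t \<in> ?f ` partly_restricted p m n r" by blast
    qed
  qed
qed

theorem theorem13p3: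
  fixes m n r l p :: nat
  assumes "m \<ge> 1" and "n \<ge> 1" and "r \<ge> 1"
    and "prime p" and "odd p" and "l = p"
    and "r \<le> m + n"
  shows "\<exists>f. bij_betw f (P_set l m n r) (tau_Lam_pp p m n r)"
proof -
  have p: "0 < p"
    using assms(4) by (rule prime_gt_0_nat)
  have "inj_on (tau n) (Lam_pp p m n r)"
    by (auto simp: tau_def intro!: inj_onI)
  then have "bij_betw (tau n) (Lam_pp p m n r) (tau_Lam_pp p m n r)"
    unfolding tau_Lam_pp_def by (rule inj_on_imp_bij_betw)
  from bij_betw_trans[OF bij_betw_inv_into[OF bij_betw_padded_index_P_set[OF p assms(7)]]
      bij_betw_trans[OF bij_betw_padded_index_partly_restricted[OF p]
        bij_betw_trans[OF bij_betw_partly_restricted_Lam_pp[OF p assms(1,7)] this]]]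
  show ?thesis
    unfolding assms(6) by blast
qed

end
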